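(* Let $\|\cdot\|$ be a norm on $\mathbb{R}^n$, $\mathcal{X}\subset\mathbb{R}^n$ compact and convex, and $\Phi:\mathcal{D}\to\mathbb{R}$ a mirror map that is $1$-strongly convex on $\mathcal{X}\cap\mathcal{D}$ with respect to $\|\cdot\|$. Let $x_1\in\mathrm{argmin}_{x\in\mathcal{X}\cap\mathcal{D}}\Phi(x)$ and $R^2=\sup_{x\in\mathcal{X}\cap\mathcal{D}}\Phi(x)-\Phi(x_1)$. Let $f$ be convex and $\beta$-smooth with respect to $\|\cdot\|$ on $\mathcal{X}$, with minimizer $x^*$ on $\mathcal{X}$, and with a stochastic oracle $\tilde g$ such that $\mathbb{E}\|\nabla f(x)-\tilde g(x)\|_*^2\le\sigma^2$ for all $x\in\mathcal{X}$, $\sigma>0$. Fix $t\ge 1$, let $\eta=\frac R\sigma\sqrt{\frac2t}$, and let stochastic mirror descent with step size $\frac{1}{\beta+1/\eta}$ be defined by $$x_{s+1}=\mathrm{argmin}_{x\in\mathcal{X}\cap\mathcal{D}}\ \frac{1}{\beta+1/\eta}\,\tilde g(x_s)^\top x+D_\Phi(x,x_s),\qquad s\ge 1.$$ Then $$\mathbb{E}f\left(\frac1t\sum_{s=1}^tx_{s+1}\right)-f(x^* )\le R\sigma\sqrt{\frac2t}+\frac{\beta R^2}{t}.$$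
   Context: The dual norm is $\|g\|_*=\sup_{\|x\|\le1}g^\top x$. $f$ is $\beta$-smooth w.r.t. $\|\cdot\|$ if it is differentiable with $\|\nabla f(x)-\nabla f(y)\|_*\le\beta\|x-y\|$ for all $x,y\in\mathcal{X}$. A (first order) stochastic oracle for $f$ takes $x\in\mathcal{X}$ and outputs a random vector $\tilde g(x)$ with $\mathbb{E}\,\tilde g(x)=\nabla f(x)$; when the query point $x$ is itself random (possibly depending on previous oracle answers), one has $\mathbb{E}(\tilde g(x)\mid x)=\nabla f(x)$, and the variance bound holds likewise at the random query points. Mirror map: $\mathcal{D}\subset\mathbb{R}^n$ is a convex open set with $\mathcal{X}\subset\overline{\mathcal{D}}$ and $\mathcal{X}\cap\mathcal{D}\ne\emptyset$; $\Phi:\mathcal{D}\to\mathbb{R}$ is a mirror map if (i) it is strictly convex and differentiable, (ii) $\nabla\Phi(\mathcal{D})=\mathbb{R}^n$, (iii) $\|\nabla\Phi(x)\|\to+\infty$ as $x\to\partial\mathcal{D}$. $\Phi$ is $1$-strongly convex on $\mathcal{X}\cap\mathcal{D}$ w.r.t. $\|\cdot\|$ if $\Phi(x)-\Phi(y)\le\nabla\Phi(x)^\top(x-y)-\frac12\|x-y\|^2$ for all $x,y\in\mathcal{X}\cap\mathcal{D}$. Bregman divergence: $D_\Phi(x,y)=\Phi(x)-\Phi(y)-\nabla\Phi(y)^\top(x-y)$. $R$ is positive, so that $1/\eta$ is well defined. *)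

theory Defs
  imports "HOL-Probability.Probability"
begin

definition is_norm :: "(real^'n \<Rightarrow> real) \<Rightarrow> bool" where
  "is_norm N \<longleftrightarrow>
     (\<forall>x. N x \<ge> 0) \<and> (\<forall>x. N x = 0 \<longleftrightarrow> x = 0) \<and>
     (\<forall>c x. N (c *\<^sub>R x) = \<bar>c\<bar> * N x) \<and> (\<forall>x y. N (x + y) \<le> N x + N y)"

definition dual_norm :: "(real^'n \<Rightarrow> real) \<Rightarrow> real^'n \<Rightarrow> real" where
  "dual_norm N g = (SUP x\<in>{x. N x \<le> 1}. g \<bullet> x)"

(* Gradients are carried as explicit functions f', Phi'.  The derivative is taken
   within X, so f need not be defined outside X.  The gradient is determined by f when
   X has nonempty interior; otherwise f' is any choice of gradient along X. *)
definition smooth_on_wrt ::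
  "(real^'n \<Rightarrow> real) \<Rightarrow> real \<Rightarrow> (real^'n) set \<Rightarrow> (real^'n \<Rightarrow> real) \<Rightarrow> (real^'n \<Rightarrow> real^'n) \<Rightarrow> bool" where
  "smooth_on_wrt N \<beta> X f f' \<longleftrightarrow>
     (\<forall>x\<in>X. (f has_derivative (\<lambda>h. h \<bullet> f' x)) (at x within X)) \<and>
     (\<forall>x\<in>X. \<forall>y\<in>X. dual_norm N (f' x - f' y) \<le> \<beta> * N (x - y))"

definition strictly_convex_on :: "(real^'n) set \<Rightarrow> (real^'n \<Rightarrow> real) \<Rightarrow> bool" where
  "strictly_convex_on S \<Phi> \<longleftrightarrow> convex S \<and>
     (\<forall>x\<in>S. \<forall>y\<in>S. \<forall>u>0. \<forall>v>0. x \<noteq> y \<longrightarrow> u + v = 1 \<longrightarrow>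
        \<Phi> (u *\<^sub>R x + v *\<^sub>R y) < u * \<Phi> x + v * \<Phi> y)"

(* The last conjunct says that N (Phi' x) tends to infinity as x in D approaches any
   boundary point of D; it is vacuous for D = UNIV. *)
definition mirror_map ::
  "(real^'n \<Rightarrow> real) \<Rightarrow> (real^'n) set \<Rightarrow> (real^'n \<Rightarrow> real) \<Rightarrow> (real^'n \<Rightarrow> real^'n) \<Rightarrow> bool" where
  "mirror_map N D \<Phi> \<Phi>' \<longleftrightarrow>
     strictly_convex_on D \<Phi> \<and> (\<forall>x\<in>D. GDERIV \<Phi> x :> \<Phi>' x) \<and>
     \<Phi>' ` D = UNIV \<and>
     (\<forall>p\<in>frontier D. filterlim (\<lambda>x. N (\<Phi>' x)) at_top (at p within D))"

definition strongly_convex_on_wrt ::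
  "(real^'n \<Rightarrow> real) \<Rightarrow> real \<Rightarrow> (real^'n) set \<Rightarrow> (real^'n \<Rightarrow> real) \<Rightarrow> (real^'n \<Rightarrow> real^'n) \<Rightarrow> bool" where
  "strongly_convex_on_wrt N \<alpha> S \<Phi> \<Phi>' \<longleftrightarrow>
     (\<forall>x\<in>S. \<forall>y\<in>S. \<Phi> x - \<Phi> y \<le> \<Phi>' x \<bullet> (x - y) - \<alpha> / 2 * (N (x - y))\<^sup>2)"

definition bregman :: "(real^'n \<Rightarrow> real) \<Rightarrow> (real^'n \<Rightarrow> real^'n) \<Rightarrow> real^'n \<Rightarrow> real^'n \<Rightarrow> real" where
  "bregman \<Phi> \<Phi>' x y = \<Phi> x - \<Phi> y - \<Phi>' y \<bullet> (x - y)"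

(* G x w is the answer of one call of the oracle at the query point x. *)
definition unbiased_on ::
  "'w measure \<Rightarrow> (real^'n) set \<Rightarrow> (real^'n \<Rightarrow> real^'n) \<Rightarrow> (real^'n \<Rightarrow> 'w \<Rightarrow> real^'n) \<Rightarrow> bool" where
  "unbiased_on M X f' G \<longleftrightarrow>
     (\<forall>x\<in>X. integrable M (G x) \<and> (\<integral>\<omega>. G x \<omega> \<partial>M) = f' x)"

(* E(G q | q) = f' q for a random query point q: conditional expectation, coordinate by
   coordinate, with respect to the sigma-algebra generated by q. *)
definition unbiased_at_random ::
  "'w measure \<Rightarrow> (real^'n \<Rightarrow> real^'n) \<Rightarrow> (real^'n \<Rightarrow> 'w \<Rightarrow> real^'n) \<Rightarrow> ('w \<Rightarrow> real^'n) \<Rightarrow> bool" where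
  "unbiased_at_random M f' G q \<longleftrightarrow>
     q \<in> borel_measurable M \<and> integrable M (\<lambda>\<omega>. G (q \<omega>) \<omega>) \<and>
     (\<forall>i. AE \<omega> in M.
        real_cond_exp M (vimage_algebra (space M) q borel) (\<lambda>\<omega>. G (q \<omega>) \<omega> $ i) \<omega> = f' (q \<omega>) $ i)"

(* E ||f' q - G q||_*^2 <= \<sigma>^2; a constant q gives the bound at a fixed point.  The
   nonnegative integral makes finiteness of the second moment part of the bound. *)
definition variance_bounded_at ::
  "(real^'n \<Rightarrow> real) \<Rightarrow> 'w measure \<Rightarrow> (real^'n \<Rightarrow> real^'n) \<Rightarrow> (real^'n \<Rightarrow> 'w \<Rightarrow> real^'n) \<Rightarrow> real
     \<Rightarrow> ('w \<Rightarrow> real^'n) \<Rightarrow> bool" where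
  "variance_bounded_at N M f' G \<sigma> q \<longleftrightarrow>
     (\<integral>\<^sup>+\<omega>. ennreal ((dual_norm N (f' (q \<omega>) - G (q \<omega>) \<omega>))\<^sup>2) \<partial>M) \<le> ennreal (\<sigma>\<^sup>2)"

(* G s is the s-th call of the oracle, so different calls may use fresh randomness. *)
definition stochastic_mirror_descent ::
  "'w measure \<Rightarrow> (real^'n) set \<Rightarrow> (real^'n) set \<Rightarrow> (real^'n \<Rightarrow> real) \<Rightarrow> (real^'n \<Rightarrow> real^'n)
     \<Rightarrow> real \<Rightarrow> (nat \<Rightarrow> real^'n \<Rightarrow> 'w \<Rightarrow> real^'n) \<Rightarrow> real^'n \<Rightarrow> (nat \<Rightarrow> 'w \<Rightarrow> real^'n) \<Rightarrow> bool" where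
  "stochastic_mirror_descent M X D \<Phi> \<Phi>' \<gamma> G x1 x \<longleftrightarrow>
     (\<forall>\<omega>\<in>space M. x 1 \<omega> = x1 \<and>
        (\<forall>s\<ge>1. is_arg_min (\<lambda>z. \<gamma> * (G s (x s \<omega>) \<omega> \<bullet> z) + bregman \<Phi> \<Phi>' z (x s \<omega>))
                  (\<lambda>z. z \<in> X \<inter> D) (x (s + 1) \<omega>)))"

end

theory Submission
  imports Defs
begin

text \<open>
  One step of the method is analysed on each trajectory separately.  For a comparison point \<open>u\<close>,
  smoothness bounds \<open>f\<close> at the new iterate by its linearization at the old one plus a quadratic
  term, and convexity bounds the linearization from \<open>u\<close>.  Exchanging the exact gradient for the
  oracle answer leaves an error term: one part pairs the noise with the displacement from the old to
  the new iterate, the other pairs it with the vector from the old iterate to \<open>u\<close>.  The first part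
  must be bounded in size, because the new iterate depends on the noise; Young's inequality turns it
  into the squared dual norm of the noise and an additional quadratic term.  Both quadratic terms
  together have constant \<open>\<beta> + 1 / \<eta>\<close>, and the step size is the inverse of it, so strong convexity
  of the mirror map cancels them against the Bregman divergence between consecutive iterates
  (\<open>noisy_mirror_step\<close>).

  What is left of the mirror step is a difference of Bregman divergences from \<open>u\<close>.  Summed along a
  trajectory these telescope to the divergence of \<open>u\<close> from the starting point, which is at most
  \<open>R\<^sup>2\<close> because the starting point minimizes \<open>\<Phi>\<close> (\<open>noisy_mirror_descent_telescope\<close>).  Only then are
  expectations taken.  The second part of the noise has mean zero, because the vector from the old
  iterate to \<open>u\<close> is determined by the query point (\<open>unbiased_noise_orthogonal\<close>), and each squared
  dual norm has mean at most \<open>\<sigma>\<^sup>2\<close>.  Jensen's inequality passes to the average of the iterates,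
  and the value of \<open>\<eta>\<close> makes the contribution \<open>\<eta> \<sigma>\<^sup>2 / 2\<close> of the variance equal to the
  contribution \<open>R\<^sup>2 / (\<eta> t)\<close> of the extra curvature.

  All of this needs \<open>u\<close> in the domain of the mirror map.  The minimizer of \<open>f\<close> may be only in the
  closure of that domain, and it is reached by a limit along a segment (\<open>convex_on_le_of_interior\<close>).
\<close>

section \<open>Norms and dual norms\<close>

lemma is_normD:
  assumes "is_norm N"
  shows "N x \<ge> 0" "N x = 0 \<longleftrightarrow> x = 0" "N (c *\<^sub>R x) = \<bar>c\<bar> * N x"
    "N (x + y) \<le> N x + N y" "N 0 = 0" "N (- x) = N x" "N (x - y) = N (y - x)"
proof -
  show "N x \<ge> 0" "N x = 0 \<longleftrightarrow> x = 0" "N (c *\<^sub>R x) = \<bar>c\<bar> * N x" "N (x + y) \<le> N x + N y"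
    using assms unfolding is_norm_def by blast+
  show "N 0 = 0"
    using assms unfolding is_norm_def by blast
  have minus: "N (- v) = N v" for v
  proof -
    have "N ((- 1) *\<^sub>R v) = \<bar>- 1\<bar> * N v"
      using assms unfolding is_norm_def by blast
    then show ?thesis by simp
  qed
  show "N (- x) = N x" by (rule minus)
  show "N (x - y) = N (y - x)" using minus[of "x - y"] by simp
qed

lemma is_norm_le_norm:
  fixes N :: "real^'n \<Rightarrow> real"
  assumes "is_norm N"
  obtains K where "K \<ge> 0" "\<And>x. N x \<le> K * norm x"
proof
  define K where "K = (\<Sum>b\<in>(Basis::(real^'n) set). N b)"
  show "K \<ge> 0"
    unfolding K_def by (intro sum_nonneg is_normD(1)[OF assms])
  have sub: "N (\<Sum>b\<in>A. h b) \<le> (\<Sum>b\<in>A. N (h b))" if "finite A"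
    for A :: "(real^'n) set" and h :: "real^'n \<Rightarrow> real^'n"
    using that
  proof (induction A rule: finite_induct)
    case empty
    then show ?case by (simp add: is_normD(5)[OF assms])
  next
    case (insert a A)
    then show ?case using is_normD(4)[OF assms, of "h a" "sum h A"] by simp
  qed
  show "N x \<le> K * norm x" for x
  proof -
    have "N x = N (\<Sum>b\<in>Basis. (x \<bullet> b) *\<^sub>R b)" by (simp add: euclidean_representation)
    also have "\<dots> \<le> (\<Sum>b\<in>Basis. N ((x \<bullet> b) *\<^sub>R b))" by (rule sub) simp
    also have "\<dots> = (\<Sum>b\<in>Basis. \<bar>x \<bullet> b\<bar> * N b)" by (simp add: is_normD(3)[OF assms])
    also have "\<dots> \<le> (\<Sum>b\<in>Basis. norm x * N b)"
      by (intro sum_mono mult_right_mono is_normD(1)[OF assms] Basis_le_norm) auto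
    also have "\<dots> = K * norm x" by (simp add: K_def sum_distrib_left mult.commute)
    finally show ?thesis .
  qed
qed

text \<open>Shared by the norm and its dual norm: the triangle inequality, applied in both directions,
  turns the bound at the origin into a Lipschitz bound everywhere.\<close>

lemma subadditive_continuous_on:
  fixes N :: "'a::real_normed_vector \<Rightarrow> real"
  assumes sub: "\<And>x y. N (x + y) \<le> N x + N y" and bound: "\<And>x. N x \<le> K * norm x"
  shows "continuous_on A N"
proof -
  have "dist (N x) (N y) \<le> K * dist x y" for x y
  proof -
    have "N x - N y \<le> K * norm (x - y)" using sub[of "x - y" y] bound[of "x - y"] by simp
    moreover have "N y - N x \<le> K * norm (x - y)"
      using sub[of "y - x" x] bound[of "y - x"] by (simp add: norm_minus_commute)
    ultimately show ?thesis by (simp add: dist_real_def dist_norm abs_le_iff)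
  qed
  moreover from this have "dist (N x) (N y) \<le> \<bar>K\<bar> * dist x y" for x y
    by (meson abs_ge_self dual_order.trans mult_right_mono zero_le_dist)
  ultimately have "\<bar>K\<bar>-lipschitz_on A N" by (intro lipschitz_onI) auto
  then show ?thesis by (rule lipschitz_on_continuous_on)
qed

text \<open>The minimum of the norm over the compact Euclidean unit sphere is positive.  This half of
  the equivalence of norms makes the supremum defining the dual norm finite.\<close>

lemma norm_le_is_norm:
  fixes N :: "real^'n \<Rightarrow> real"
  assumes "is_norm N"
  obtains C where "C > 0" "\<And>x. norm x \<le> C * N x"
proof -
  obtain K where K: "K \<ge> 0" "\<And>x. N x \<le> K * norm x"
    using is_norm_le_norm[OF assms] by blast
  have "continuous_on (sphere 0 1) N"
    using is_normD(4)[OF assms] K(2) by (rule subadditive_continuous_on)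
  moreover have "sphere (0::real^'n) 1 \<noteq> {}" by simp
  ultimately obtain z where z: "z \<in> sphere 0 1" "\<And>y. y \<in> sphere 0 1 \<Longrightarrow> N z \<le> N y"
    using continuous_attains_inf[OF compact_sphere] by metis
  have "z \<noteq> 0" using z(1) by auto
  then have "N z \<noteq> 0" by (simp add: is_normD(2)[OF assms])
  then have pos: "N z > 0" using is_normD(1)[OF assms, of z] by linarith
  have "norm x \<le> 1 / N z * N x" for x
  proof (cases "x = 0")
    case True
    then show ?thesis by (simp add: is_normD(5)[OF assms])
  next
    case False
    then have "N z \<le> N ((1 / norm x) *\<^sub>R x)" by (intro z(2)) simp
    also have "\<dots> = N x / norm x" by (simp add: is_normD(3)[OF assms])
    finally show ?thesis using False pos by (simp add: field_simps)
  qed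
  then show ?thesis using pos by (intro that[of "1 / N z"]) auto
qed

lemma inner_le_on_unit_ball:
  fixes N :: "real^'n \<Rightarrow> real"
  assumes "is_norm N"
  obtains C where "\<And>g y. N y \<le> 1 \<Longrightarrow> g \<bullet> y \<le> C * norm g"
proof -
  obtain C where C: "C > 0" "\<And>x. norm x \<le> C * N x"
    using norm_le_is_norm[OF assms] by blast
  have "g \<bullet> y \<le> C * norm g" if "N y \<le> 1" for g y
  proof -
    have "g \<bullet> y \<le> norm g * norm y" by (rule norm_cauchy_schwarz)
    also have "\<dots> \<le> norm g * (C * 1)"
      using C(2)[of y] mult_left_mono[OF that, of C] C(1) by (intro mult_left_mono norm_ge_zero) linarith
    finally show ?thesis by (simp add: mult.commute)
  qed
  then show ?thesis by (rule that)
qed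

lemma dual_norm_upper:
  assumes "is_norm N" "N x \<le> 1"
  shows "g \<bullet> x \<le> dual_norm N g"
proof -
  obtain C where "\<And>g y. N y \<le> 1 \<Longrightarrow> g \<bullet> y \<le> C * norm g"
    using inner_le_on_unit_ball[OF assms(1)] by blast
  then have "bdd_above ((\<lambda>x. g \<bullet> x) ` {x. N x \<le> 1})"
    by (intro bdd_aboveI2[where M = "C * norm g"]) simp
  moreover have "x \<in> {x. N x \<le> 1}" using assms(2) by simp
  ultimately show ?thesis
    unfolding dual_norm_def by (intro cSUP_upper)
qed

lemma dual_norm_least:
  assumes "is_norm N" "\<And>x. N x \<le> 1 \<Longrightarrow> g \<bullet> x \<le> B"
  shows "dual_norm N g \<le> B"
  unfolding dual_norm_def
proof (rule cSUP_least)
  have "0 \<in> {x. N x \<le> 1}" by (simp add: is_normD(5)[OF assms(1)])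
  then show "{x. N x \<le> 1} \<noteq> {}" by blast
qed (use assms(2) in auto)

lemma dual_norm_nonneg: "is_norm N \<Longrightarrow> dual_norm N g \<ge> 0"
  using dual_norm_upper[of N 0 g] by (simp add: is_normD(5))

lemma inner_le_dual_norm:
  assumes "is_norm N"
  shows "g \<bullet> x \<le> dual_norm N g * N x"
proof (cases "x = 0")
  case True
  then show ?thesis by (simp add: is_normD(5)[OF assms])
next
  case False
  then have pos: "N x > 0" using is_normD(1,2)[OF assms, of x] by linarith
  have "g \<bullet> ((1 / N x) *\<^sub>R x) \<le> dual_norm N g"
    using pos by (intro dual_norm_upper assms) (simp add: is_normD(3)[OF assms])
  then show ?thesis using pos by (simp add: field_simps)
qed

lemma dual_norm_continuous_on:
  fixes N :: "real^'n \<Rightarrow> real"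
  assumes "is_norm N"
  shows "continuous_on A (dual_norm N)"
proof -
  obtain C where C: "\<And>g y. N y \<le> 1 \<Longrightarrow> g \<bullet> y \<le> C * norm g"
    using inner_le_on_unit_ball[OF assms] by blast
  show ?thesis
  proof (rule subadditive_continuous_on)
    show "dual_norm N (g + h) \<le> dual_norm N g + dual_norm N h" for g h
      by (rule dual_norm_least[OF assms])
        (auto simp: inner_add_left intro!: add_mono dual_norm_upper assms)
    show "dual_norm N g \<le> C * norm g" for g
      by (rule dual_norm_least[OF assms]) (rule C)
  qed
qed

text \<open>Pairing \<open>g\<close> with itself bounds its Euclidean norm.  This transfers a Lipschitz condition stated
  in the dual norm to the Euclidean metric.\<close>

lemma norm_le_dual_norm:
  assumes "is_norm N" "K \<ge> 0" "\<And>x. N x \<le> K * norm x"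
  shows "norm g \<le> K * dual_norm N g"
proof (cases "g = 0")
  case True
  then show ?thesis using assms(2) dual_norm_nonneg[OF assms(1)] by simp
next
  case False
  have "norm g * norm g = g \<bullet> g" by (simp add: dot_square_norm power2_eq_square)
  also have "\<dots> \<le> dual_norm N g * N g" by (rule inner_le_dual_norm[OF assms(1)])
  also have "\<dots> \<le> dual_norm N g * (K * norm g)"
    by (intro mult_left_mono assms(3) dual_norm_nonneg assms(1))
  also have "\<dots> = (K * dual_norm N g) * norm g" by simp
  finally show ?thesis using False by (simp only: mult_le_cancel_right) simp
qed

section \<open>Differentiation along segments\<close>

lemma has_derivative_along_segment:
  fixes f :: "'a::real_inner \<Rightarrow> real"
  assumes "convex S" "x \<in> S" "y \<in> S" "\<tau> \<in> {0..1}"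
    and "(f has_derivative (\<lambda>h. h \<bullet> v)) (at (x + \<tau> *\<^sub>R (y - x)) within S)"
  shows "((\<lambda>r. f (x + r *\<^sub>R (y - x))) has_real_derivative (y - x) \<bullet> v) (at \<tau> within {0..1})"
proof -
  have in_S: "(\<lambda>r. x + r *\<^sub>R (y - x)) ` {0..1} \<subseteq> S"
  proof safe
    fix r :: real assume "r \<in> {0..1}"
    then have "(1 - r) *\<^sub>R x + r *\<^sub>R y \<in> S" using assms(1-3) by (intro convexD) auto
    then show "x + r *\<^sub>R (y - x) \<in> S" by (simp add: algebra_simps)
  qed
  have "((\<lambda>r. x + r *\<^sub>R (y - x)) has_derivative (\<lambda>r. r *\<^sub>R (y - x))) (at \<tau> within {0..1})"
    by (auto intro!: derivative_eq_intros)
  moreover have "(f has_derivative (\<lambda>h. h \<bullet> v))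
      (at (x + \<tau> *\<^sub>R (y - x)) within (\<lambda>r. x + r *\<^sub>R (y - x)) ` {0..1})"
    using assms(5) in_S by (rule has_derivative_subset)
  ultimately have "(f \<circ> (\<lambda>r. x + r *\<^sub>R (y - x)) has_derivative
      (\<lambda>h. h \<bullet> v) \<circ> (\<lambda>r. r *\<^sub>R (y - x))) (at \<tau> within {0..1})"
    by (rule diff_chain_within)
  then show ?thesis
    by (simp add: has_field_derivative_def o_def mult.commute[of _ "(y - x) \<bullet> v"])
qed

lemma arg_min_first_order:
  fixes F :: "'a::real_inner \<Rightarrow> real"
  assumes "convex S" "is_arg_min F (\<lambda>z. z \<in> S) z" "u \<in> S"
    and "(F has_derivative (\<lambda>h. h \<bullet> v)) (at z within S)"
  shows "(u - z) \<bullet> v \<ge> 0"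
proof (rule ccontr)
  assume neg: "\<not> (u - z) \<bullet> v \<ge> 0"
  have z: "z \<in> S" "\<And>y. y \<in> S \<Longrightarrow> F z \<le> F y"
    using assms(2) by (auto simp: is_arg_min_def not_less)
  have "((\<lambda>r. F (z + r *\<^sub>R (u - z))) has_real_derivative (u - z) \<bullet> v) (at 0 within {0..1})"
    using has_derivative_along_segment[OF assms(1) z(1) assms(3), of 0 F v] assms(4) by simp
  from has_real_derivative_neg_dec_right[OF this] neg
  obtain d where d: "d > 0"
    "\<And>h. h > 0 \<Longrightarrow> h \<in> {0..1} \<Longrightarrow> h < d \<Longrightarrow> F (z + h *\<^sub>R (u - z)) < F z"
    by auto
  define h where "h = min 1 (d / 2)"
  have h: "h > 0" "h \<in> {0..1}" "h < d" using d(1) by (auto simp: h_def min_def)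
  have "(1 - h) *\<^sub>R z + h *\<^sub>R u \<in> S" using h z(1) assms(1,3) by (intro convexD) auto
  then have "F z \<le> F (z + h *\<^sub>R (u - z))" using z(2) by (simp add: algebra_simps)
  with d(2)[OF h] show False by simp
qed

text \<open>The function \<open>r \<mapsto> f (x + r (y - x)) - r (f y - f x)\<close> on the unit interval is largest at 0 by
  convexity, so its one-sided slope there cannot be positive.\<close>

lemma convex_on_gradient_inequality:
  fixes f :: "'a::real_inner \<Rightarrow> real"
  assumes "convex_on S f" "x \<in> S" "y \<in> S"
    and "(f has_derivative (\<lambda>h. h \<bullet> v)) (at x within S)"
  shows "f x + (y - x) \<bullet> v \<le> f y"
proof (rule ccontr)
  assume neg: "\<not> f x + (y - x) \<bullet> v \<le> f y"
  have S: "convex S" using assms(1) by (rule convex_on_imp_convex)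
  have "((\<lambda>r. f (x + r *\<^sub>R (y - x))) has_real_derivative (y - x) \<bullet> v) (at 0 within {0..1})"
    using has_derivative_along_segment[OF S assms(2,3), of 0 f v] assms(4) by simp
  then have "((\<lambda>r. f (x + r *\<^sub>R (y - x)) - r * (f y - f x)) has_real_derivative
      (y - x) \<bullet> v - (f y - f x)) (at 0 within {0..1})"
    by (auto intro!: derivative_eq_intros)
  from has_real_derivative_pos_inc_right[OF this] neg
  obtain d where d: "d > 0"
    "\<And>h. h > 0 \<Longrightarrow> h \<in> {0..1} \<Longrightarrow> h < d \<Longrightarrow> f x < f (x + h *\<^sub>R (y - x)) - h * (f y - f x)"
    by auto
  define h where "h = min 1 (d / 2)"
  have h: "h > 0" "h \<in> {0..1}" "h < d" using d(1) by (auto simp: h_def min_def)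
  have "f ((1 - h) *\<^sub>R x + h *\<^sub>R y) \<le> (1 - h) * f x + h * f y"
    using h by (intro convex_onD[OF assms(1)] assms) auto
  then have "f (x + h *\<^sub>R (y - x)) - h * (f y - f x) \<le> f x" by (simp add: algebra_simps)
  with d(2)[OF h] show False by simp
qed

text \<open>Along the segment from \<open>x\<close> to \<open>y\<close> the slope of \<open>f\<close> at parameter \<open>r\<close> exceeds its initial
  value by at most \<open>\<beta> r (N (y - x))\<^sup>2\<close>; integrating this from 0 to 1 gives the factor one half.
  The integral is replaced by monotonicity of the difference of both sides.\<close>

lemma smooth_on_wrt_descent:
  fixes f :: "real^'n \<Rightarrow> real"
  assumes N: "is_norm N" and X: "convex X" and smooth: "smooth_on_wrt N \<beta> X f f'"
    and x: "x \<in> X" and y: "y \<in> X"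
  shows "f y \<le> f x + (y - x) \<bullet> f' x + \<beta> / 2 * (N (y - x))\<^sup>2"
proof -
  define p where "p r = x + r *\<^sub>R (y - x)" for r
  define \<psi> where "\<psi> r = f (p r) - r * ((y - x) \<bullet> f' x) - \<beta> / 2 * r\<^sup>2 * (N (y - x))\<^sup>2" for r
  have p_in: "p r \<in> X" if "r \<in> {0..1}" for r
  proof -
    have "(1 - r) *\<^sub>R x + r *\<^sub>R y \<in> X" using that x y X by (intro convexD) auto
    then show ?thesis by (simp add: p_def algebra_simps)
  qed
  have der: "(\<psi> has_real_derivative
      (y - x) \<bullet> f' (p r) - (y - x) \<bullet> f' x - \<beta> * r * (N (y - x))\<^sup>2) (at r within {0..1})"
    if r: "r \<in> {0..1}" for r
  proof -
    have "(f has_derivative (\<lambda>h. h \<bullet> f' (p r))) (at (p r) within X)"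
      using smooth p_in[OF r] unfolding smooth_on_wrt_def by blast
    then have "((\<lambda>r. f (p r)) has_real_derivative (y - x) \<bullet> f' (p r)) (at r within {0..1})"
      unfolding p_def by (rule has_derivative_along_segment[OF X x y r])
    then show ?thesis
      unfolding \<psi>_def by (auto intro!: derivative_eq_intros)
  qed
  have "\<psi> 0 \<ge> \<psi> 1"
  proof (rule DERIV_nonpos_imp_decreasing_open[where f = \<psi>])
    show "continuous_on {0..1} \<psi>"
      using der by (meson DERIV_continuous continuous_on_eq_continuous_within)
    fix r :: real assume r: "0 < r" "r < 1"
    have "(y - x) \<bullet> f' (p r) - (y - x) \<bullet> f' x = (f' (p r) - f' x) \<bullet> (y - x)"
      by (simp add: inner_diff_left inner_diff_right inner_commute)
    also have "\<dots> \<le> dual_norm N (f' (p r) - f' x) * N (y - x)"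
      by (rule inner_le_dual_norm[OF N])
    also have "\<dots> \<le> (\<beta> * N (p r - x)) * N (y - x)"
      using smooth p_in[of r] r x is_normD(1)[OF N]
      by (intro mult_right_mono) (auto simp: smooth_on_wrt_def)
    also have "N (p r - x) = r * N (y - x)"
      using r by (simp add: p_def is_normD(3)[OF N])
    finally have "(y - x) \<bullet> f' (p r) - (y - x) \<bullet> f' x - \<beta> * r * (N (y - x))\<^sup>2 \<le> 0"
      by (simp add: power2_eq_square mult_ac)
    moreover have "at r within {0..1} = at r"
      using r by (intro at_within_interior) (simp add: interior_atLeastAtMost_real)
    ultimately show "\<exists>d. DERIV \<psi> r :> d \<and> d \<le> 0" using der[of r] r by auto
  qed simp
  then show ?thesis by (simp add: \<psi>_def p_def)
qed

lemma smooth_on_wrt_const_nonneg: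
  assumes "is_norm N" "smooth_on_wrt N \<beta> X f f'" "x \<in> X" "y \<in> X" "x \<noteq> y"
  shows "\<beta> \<ge> 0"
proof -
  have "N (x - y) > 0"
    using is_normD(1,2)[OF assms(1), of "x - y"] assms(5) by (simp add: less_le)
  moreover have "0 \<le> \<beta> * N (x - y)"
    using dual_norm_nonneg[OF assms(1), of "f' x - f' y"] assms(2-4)
    unfolding smooth_on_wrt_def by force
  ultimately show ?thesis by (simp add: zero_le_mult_iff)
qed

lemma smooth_on_wrt_gradient_continuous:
  fixes f :: "real^'n \<Rightarrow> real"
  assumes "is_norm N" "smooth_on_wrt N \<beta> X f f'"
  shows "continuous_on X f'"
proof -
  obtain K where K: "K \<ge> 0" "\<And>x. N x \<le> K * norm x"
    using is_norm_le_norm[OF assms(1)] by blast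
  have "dist (f' x) (f' y) \<le> (K * \<bar>\<beta>\<bar> * K) * dist x y" if "x \<in> X" "y \<in> X" for x y
  proof -
    have "norm (f' x - f' y) \<le> K * dual_norm N (f' x - f' y)"
      using assms(1) K by (rule norm_le_dual_norm)
    also have "\<dots> \<le> K * (\<beta> * N (x - y))"
      using assms(2) that K(1) unfolding smooth_on_wrt_def by (intro mult_left_mono) auto
    also have "\<dots> \<le> K * (\<bar>\<beta>\<bar> * N (x - y))"
      using K(1) is_normD(1)[OF assms(1)] by (intro mult_left_mono mult_right_mono) auto
    also have "\<dots> \<le> K * (\<bar>\<beta>\<bar> * (K * norm (x - y)))"
      using K by (intro mult_left_mono) auto
    finally show ?thesis by (simp add: dist_norm mult_ac)
  qed
  then have "(K * \<bar>\<beta>\<bar> * K)-lipschitz_on X f'" using K(1) by (intro lipschitz_onI) auto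
  then show ?thesis by (rule lipschitz_on_continuous_on)
qed

section \<open>One step of mirror descent\<close>

text \<open>The first-order condition for the minimizer \<open>z\<close> reads
  \<open>(\<gamma> g + \<Phi>' z - \<Phi>' y) \<bullet> (u - z) \<ge> 0\<close>, and the three-point identity rewrites
  \<open>(\<Phi>' z - \<Phi>' y) \<bullet> (u - z)\<close> as the combination of Bregman divergences on the right.\<close>

lemma mirror_step_three_point:
  assumes "convex S" "GDERIV \<Phi> z :> \<Phi>' z" "u \<in> S"
    and "is_arg_min (\<lambda>z. \<gamma> * (g \<bullet> z) + bregman \<Phi> \<Phi>' z y) (\<lambda>z. z \<in> S) z"
  shows "\<gamma> * (g \<bullet> (z - u)) \<le> bregman \<Phi> \<Phi>' u y - bregman \<Phi> \<Phi>' u z - bregman \<Phi> \<Phi>' z y"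
proof -
  have "(\<Phi> has_derivative (\<lambda>h. h \<bullet> \<Phi>' z)) (at z within S)"
    using assms(2) unfolding gderiv_def by (rule has_derivative_at_withinI)
  then have "((\<lambda>z. \<gamma> * (g \<bullet> z) + bregman \<Phi> \<Phi>' z y) has_derivative
      (\<lambda>h. h \<bullet> (\<gamma> *\<^sub>R g + \<Phi>' z - \<Phi>' y))) (at z within S)"
    unfolding bregman_def
    by (auto intro!: derivative_eq_intros simp: inner_diff_right inner_add_right inner_commute fun_eq_iff)
  from arg_min_first_order[OF assms(1,4,3) this] show ?thesis
    unfolding bregman_def by (simp add: algebra_simps inner_commute)
qed

lemma bregman_ge_half_square:
  assumes "is_norm N" "strongly_convex_on_wrt N 1 S \<Phi> \<Phi>'" "x \<in> S" "y \<in> S"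
  shows "bregman \<Phi> \<Phi>' x y \<ge> 1 / 2 * (N (x - y))\<^sup>2"
proof -
  have "\<Phi> y - \<Phi> x \<le> \<Phi>' y \<bullet> (y - x) - 1 / 2 * (N (y - x))\<^sup>2"
    using assms(2-4) unfolding strongly_convex_on_wrt_def by blast
  moreover have "\<Phi>' y \<bullet> (y - x) = - (\<Phi>' y \<bullet> (x - y))" by (simp add: inner_diff_right)
  ultimately show ?thesis
    unfolding bregman_def is_normD(7)[OF assms(1), of x y] by linarith
qed

text \<open>Replacing the exact gradient at \<open>y\<close> by \<open>g\<close> in the descent inequality costs
  \<open>(f' y - g) \<bullet> (z - u)\<close>.  The part along \<open>z - y\<close> is split by Young's inequality with parameter
  \<open>\<eta>\<close>: its square \<open>(N (z - y))\<^sup>2\<close> raises the smoothness constant to \<open>\<beta> + 1 / \<eta>\<close>, which the step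
  size is tuned to cancel against the Bregman divergence.  The part along \<open>y - u\<close> does not involve
  the new point \<open>z\<close>, so it is linear in the noise and has mean zero.\<close>

lemma noisy_mirror_step:
  fixes f :: "real^'n \<Rightarrow> real"
  assumes N: "is_norm N" and X: "convex_on X f" and smooth: "smooth_on_wrt N \<beta> X f f'"
    and S: "convex S" "S \<subseteq> X" and strong: "strongly_convex_on_wrt N 1 S \<Phi> \<Phi>'"
    and gderiv: "GDERIV \<Phi> z :> \<Phi>' z" and \<eta>: "\<eta> > 0" and pos: "\<beta> + 1 / \<eta> > 0"
    and y: "y \<in> S" and u: "u \<in> S"
    and arg_min: "is_arg_min (\<lambda>z. 1 / (\<beta> + 1 / \<eta>) * (g \<bullet> z) + bregman \<Phi> \<Phi>' z y) (\<lambda>z. z \<in> S) z"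
  shows "f z \<le> f u + (g - f' y) \<bullet> (u - y) + \<eta> / 2 * (dual_norm N (f' y - g))\<^sup>2
    + (\<beta> + 1 / \<eta>) * (bregman \<Phi> \<Phi>' u y - bregman \<Phi> \<Phi>' u z)"
proof -
  define L where "L = \<beta> + 1 / \<eta>"
  define a where "a = dual_norm N (f' y - g)"
  define b where "b = N (z - y)"
  have z: "z \<in> S" using arg_min by (simp add: is_arg_min_def)
  have descent: "f z \<le> f y + (z - y) \<bullet> f' y + \<beta> / 2 * b\<^sup>2"
    unfolding b_def
    using smooth_on_wrt_descent[OF N convex_on_imp_convex[OF X] smooth] y z S(2) by blast
  have grad: "f y + (u - y) \<bullet> f' y \<le> f u"
    using smooth y u S(2)
    by (intro convex_on_gradient_inequality[OF X]) (auto simp: smooth_on_wrt_def)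
  have "(f' y - g) \<bullet> (z - y) \<le> a * b"
    unfolding a_def b_def by (rule inner_le_dual_norm[OF N])
  also have "\<dots> \<le> \<eta> / 2 * a\<^sup>2 + 1 / (2 * \<eta>) * b\<^sup>2"
  proof -
    have "0 \<le> (\<eta> * a - b)\<^sup>2 / (2 * \<eta>)" using \<eta> by simp
    also have "\<dots> = \<eta> / 2 * a\<^sup>2 + 1 / (2 * \<eta>) * b\<^sup>2 - a * b"
      using \<eta> by (simp add: field_simps power2_eq_square)
    finally show ?thesis by simp
  qed
  finally have young: "(f' y - g) \<bullet> (z - y) \<le> \<eta> / 2 * a\<^sup>2 + 1 / (2 * \<eta>) * b\<^sup>2" .
  have "1 / L * (g \<bullet> (z - u)) \<le>
      bregman \<Phi> \<Phi>' u y - bregman \<Phi> \<Phi>' u z - bregman \<Phi> \<Phi>' z y"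
    unfolding L_def by (rule mirror_step_three_point[OF S(1) gderiv u arg_min])
  also have "\<dots> \<le> bregman \<Phi> \<Phi>' u y - bregman \<Phi> \<Phi>' u z - 1 / 2 * b\<^sup>2"
    unfolding b_def using bregman_ge_half_square[OF N strong z y] by linarith
  finally have "g \<bullet> (z - u) \<le> L * (bregman \<Phi> \<Phi>' u y - bregman \<Phi> \<Phi>' u z - 1 / 2 * b\<^sup>2)"
    using pos unfolding L_def[symmetric] by (simp add: divide_le_eq mult.commute)
  then have step: "g \<bullet> (z - u) \<le> L * (bregman \<Phi> \<Phi>' u y - bregman \<Phi> \<Phi>' u z)
      - \<beta> / 2 * b\<^sup>2 - 1 / (2 * \<eta>) * b\<^sup>2"
    by (simp add: L_def algebra_simps add_divide_distrib)
  have "f z \<le> f u + ((z - y) \<bullet> f' y - (u - y) \<bullet> f' y) + \<beta> / 2 * b\<^sup>2"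
    using descent grad by linarith
  also have "(z - y) \<bullet> f' y - (u - y) \<bullet> f' y
      = g \<bullet> (z - u) + (g - f' y) \<bullet> (u - y) + (f' y - g) \<bullet> (z - y)"
    by (simp add: algebra_simps inner_commute)
  finally have "f z \<le> f u + (g \<bullet> (z - u) + (g - f' y) \<bullet> (u - y) + (f' y - g) \<bullet> (z - y))
      + \<beta> / 2 * b\<^sup>2"
    by linarith
  with step young show ?thesis unfolding a_def L_def by linarith
qed

text \<open>The Bregman divergences telescope along each trajectory, so that only the deterministic
  starting point enters and no divergence has to be measurable or integrable.\<close>

lemma noisy_mirror_descent_telescope:
  fixes f :: "real^'n \<Rightarrow> real" and y g :: "nat \<Rightarrow> real^'n"
  assumes N: "is_norm N" and X: "convex_on X f" and smooth: "smooth_on_wrt N \<beta> X f f'"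
    and S: "convex S" "S \<subseteq> X" and strong: "strongly_convex_on_wrt N 1 S \<Phi> \<Phi>'"
    and gderiv: "\<And>z. z \<in> S \<Longrightarrow> GDERIV \<Phi> z :> \<Phi>' z" and \<eta>: "\<eta> > 0" and pos: "\<beta> + 1 / \<eta> > 0"
    and u: "u \<in> S" and start: "y 1 \<in> S"
    and step: "\<And>s. s \<ge> 1 \<Longrightarrow> is_arg_min
      (\<lambda>z. 1 / (\<beta> + 1 / \<eta>) * (g s \<bullet> z) + bregman \<Phi> \<Phi>' z (y s)) (\<lambda>z. z \<in> S) (y (s + 1))"
  shows "(\<Sum>s=1..t. f (y (s + 1))) \<le> real t * f u
    + (\<Sum>s=1..t. (g s - f' (y s)) \<bullet> (u - y s) + \<eta> / 2 * (dual_norm N (f' (y s) - g s))\<^sup>2)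
    + (\<beta> + 1 / \<eta>) * bregman \<Phi> \<Phi>' u (y 1)"
proof -
  have in_S: "y (Suc s) \<in> S" for s
    using start step[of s] by (cases s) (auto simp: is_arg_min_def)
  define h where
    "h s = (g s - f' (y s)) \<bullet> (u - y s) + \<eta> / 2 * (dual_norm N (f' (y s) - g s))\<^sup>2" for s
  have one: "f (y (Suc (Suc k))) \<le> f u + h (Suc k)
      + (\<beta> + 1 / \<eta>) * (bregman \<Phi> \<Phi>' u (y (Suc k)) - bregman \<Phi> \<Phi>' u (y (Suc (Suc k))))" for k
    using noisy_mirror_step[OF N X smooth S strong gderiv[OF in_S] \<eta> pos in_S u, of "g (Suc k)" k "Suc k"]
      step[of "Suc k"] by (simp add: h_def add.assoc)
  have "(\<Sum>s=1..t. f (y (s + 1))) \<le> real t * f u + (\<Sum>s=1..t. h s)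
      + (\<beta> + 1 / \<eta>) * (bregman \<Phi> \<Phi>' u (y 1) - bregman \<Phi> \<Phi>' u (y (Suc t)))"
  proof (induction t)
    case 0
    then show ?case by simp
  next
    case (Suc t)
    then show ?case using one[of t] by (simp add: algebra_simps)
  qed
  moreover have "bregman \<Phi> \<Phi>' u (y (Suc t)) \<ge> 0"
    using bregman_ge_half_square[OF N strong u in_S[of t]]
    by (meson order_trans mult_nonneg_nonneg zero_le_power2 zero_le_divide_1_iff zero_le_numeral)
  then have "(\<beta> + 1 / \<eta>) * (bregman \<Phi> \<Phi>' u (y 1) - bregman \<Phi> \<Phi>' u (y (Suc t)))
      \<le> (\<beta> + 1 / \<eta>) * bregman \<Phi> \<Phi>' u (y 1)"
    using pos by (intro mult_left_mono) auto
  ultimately show ?thesis unfolding h_def by linarith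
qed

section \<open>Expectations\<close>

lemma borel_measurable_continuous_on_range:
  fixes h :: "'a::topological_space \<Rightarrow> 'b::topological_space"
  assumes "continuous_on X h" "q \<in> borel_measurable M" "\<And>\<omega>. \<omega> \<in> space M \<Longrightarrow> q \<omega> \<in> X"
  shows "(\<lambda>\<omega>. h (q \<omega>)) \<in> borel_measurable M"
proof (rule measurable_compose[where N = "restrict_space borel X" and g = h])
  show "q \<in> measurable M (restrict_space borel X)"
    using assms by (intro measurable_restrict_space2) auto
  show "h \<in> borel_measurable (restrict_space borel X)"
    using assms(1) by (rule borel_measurable_continuous_on_restrict)
qed

text \<open>The direction \<open>u - q\<close> is a function of the query point, so conditioning on \<open>q\<close> replaces
  the oracle answer by the gradient.  This is done for each coordinate of the inner product.\<close>

lemma unbiased_noise_orthogonal: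
  fixes f' :: "real^'n \<Rightarrow> real^'n"
  assumes "prob_space M" and X: "compact X" and cont: "continuous_on X f'"
    and unbiased: "unbiased_at_random M f' G q" and q_in: "\<And>\<omega>. \<omega> \<in> space M \<Longrightarrow> q \<omega> \<in> X"
  shows "integrable M (\<lambda>\<omega>. (G (q \<omega>) \<omega> - f' (q \<omega>)) \<bullet> (u - q \<omega>))"
    and "(\<integral>\<omega>. (G (q \<omega>) \<omega> - f' (q \<omega>)) \<bullet> (u - q \<omega>) \<partial>M) = 0"
proof -
  interpret prob_space M by fact
  define F where "F = vimage_algebra (space M) q borel"
  have q [measurable]: "q \<in> borel_measurable M"
    and G_int: "integrable M (\<lambda>\<omega>. G (q \<omega>) \<omega>)"
    and cond: "AE \<omega> in M. real_cond_exp M F (\<lambda>\<omega>. G (q \<omega>) \<omega> $ i) \<omega> = f' (q \<omega>) $ i" for i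
    using unbiased unfolding unbiased_at_random_def F_def by auto
  have sub: "subalgebra M F"
    unfolding subalgebra_def F_def using sets_image_in_sets[OF refl q] by simp
  interpret finite_measure_subalgebra M F
    using sub by unfold_locales
  have qF: "q \<in> borel_measurable F"
    unfolding F_def by (rule measurable_vimage_algebra1) simp
  obtain B where B: "\<And>z. z \<in> X \<Longrightarrow> norm z \<le> B"
    using compact_imp_bounded[OF X] by (auto simp: bounded_iff)
  have "integrable M (\<lambda>\<omega>. (G (q \<omega>) \<omega> $ i - f' (q \<omega>) $ i) * (u $ i - q \<omega> $ i))
    \<and> (\<integral>\<omega>. (G (q \<omega>) \<omega> $ i - f' (q \<omega>) $ i) * (u $ i - q \<omega> $ i) \<partial>M) = 0" for i
  proof -
    define h where "h \<omega> = u $ i - q \<omega> $ i" for \<omega>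
    define a where "a \<omega> = G (q \<omega>) \<omega> $ i" for \<omega>
    have hF [measurable]: "h \<in> borel_measurable F"
      unfolding h_def
      by (rule measurable_compose[OF qF borel_measurable_continuous_onI])
        (intro continuous_intros)
    have h [measurable]: "h \<in> borel_measurable M"
      by (rule measurable_from_subalg[OF sub hF])
    have a_int: "integrable M a"
      unfolding a_def using G_int
      by (rule integrable_bounded_linear[OF bounded_linear_vec_nth])
    then have a [measurable]: "a \<in> borel_measurable M" by simp
    have h_bound: "\<bar>h \<omega>\<bar> \<le> norm u + B" if "\<omega> \<in> space M" for \<omega>
      unfolding h_def
      using component_le_norm_cart[of u i] component_le_norm_cart[of "q \<omega>" i] B[OF q_in[OF that]]
      by linarith
    \<comment> \<open>An integrable oracle answer times a factor that is bounded because \<open>X\<close> is compact.\<close>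
    have ha_int: "integrable M (\<lambda>\<omega>. h \<omega> * a \<omega>)"
    proof (rule Bochner_Integration.integrable_bound)
      show "integrable M (\<lambda>\<omega>. (norm u + B) * a \<omega>)" using a_int by simp
      show "AE \<omega> in M. norm (h \<omega> * a \<omega>) \<le> norm ((norm u + B) * a \<omega>)"
      proof (rule AE_I2)
        fix \<omega> assume "\<omega> \<in> space M"
        from h_bound[OF this] show "norm (h \<omega> * a \<omega>) \<le> norm ((norm u + B) * a \<omega>)"
          by (auto simp: abs_mult intro!: mult_right_mono)
      qed
    qed simp
    have cond': "AE \<omega> in M. real_cond_exp M F a \<omega> = f' (q \<omega>) $ i"
      unfolding a_def by (rule cond)
    have [measurable]: "(\<lambda>\<omega>. f' (q \<omega>) $ i) \<in> borel_measurable M"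
      by (rule borel_measurable_continuous_on_range[of X "\<lambda>z. f' z $ i", OF _ q q_in])
        (use cont in \<open>auto intro!: continuous_intros\<close>)
    have eq: "AE \<omega> in M. h \<omega> * real_cond_exp M F a \<omega> = h \<omega> * f' (q \<omega>) $ i"
      using cond' by auto
    have ce: "integrable M (\<lambda>\<omega>. h \<omega> * real_cond_exp M F a \<omega>)"
      "(\<integral>\<omega>. h \<omega> * real_cond_exp M F a \<omega> \<partial>M) = (\<integral>\<omega>. h \<omega> * a \<omega> \<partial>M)"
      using real_cond_exp_intg[OF ha_int hF a] by auto
    have hf_int: "integrable M (\<lambda>\<omega>. h \<omega> * f' (q \<omega>) $ i)"
      by (rule integrable_cong_AE_imp[OF ce(1) _ eq]) simp
    have hf: "(\<integral>\<omega>. h \<omega> * f' (q \<omega>) $ i \<partial>M) = (\<integral>\<omega>. h \<omega> * a \<omega> \<partial>M)"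
      using integral_cong_AE[OF _ _ eq] ce(2) by simp
    have "(\<lambda>\<omega>. (G (q \<omega>) \<omega> $ i - f' (q \<omega>) $ i) * (u $ i - q \<omega> $ i))
        = (\<lambda>\<omega>. h \<omega> * a \<omega> - h \<omega> * f' (q \<omega>) $ i)"
      by (simp add: h_def a_def algebra_simps)
    then show ?thesis using ha_int hf_int hf by simp
  qed
  then show "integrable M (\<lambda>\<omega>. (G (q \<omega>) \<omega> - f' (q \<omega>)) \<bullet> (u - q \<omega>))"
    and "(\<integral>\<omega>. (G (q \<omega>) \<omega> - f' (q \<omega>)) \<bullet> (u - q \<omega>) \<partial>M) = 0"
    by (simp_all add: inner_vec_def)
qed

lemma variance_bounded_at_expectation:
  fixes f' :: "real^'n \<Rightarrow> real^'n"
  assumes N: "is_norm N" and cont: "continuous_on X f'"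
    and unbiased: "unbiased_at_random M f' G q" and q_in: "\<And>\<omega>. \<omega> \<in> space M \<Longrightarrow> q \<omega> \<in> X"
    and var: "variance_bounded_at N M f' G \<sigma> q"
  shows "integrable M (\<lambda>\<omega>. (dual_norm N (f' (q \<omega>) - G (q \<omega>) \<omega>))\<^sup>2)"
    and "(\<integral>\<omega>. (dual_norm N (f' (q \<omega>) - G (q \<omega>) \<omega>))\<^sup>2 \<partial>M) \<le> \<sigma>\<^sup>2"
proof -
  let ?V = "\<lambda>\<omega>. (dual_norm N (f' (q \<omega>) - G (q \<omega>) \<omega>))\<^sup>2"
  have q: "q \<in> borel_measurable M" and G_int: "integrable M (\<lambda>\<omega>. G (q \<omega>) \<omega>)"
    using unbiased unfolding unbiased_at_random_def by auto
  have [measurable]: "(\<lambda>\<omega>. f' (q \<omega>)) \<in> borel_measurable M"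
    using cont q q_in by (rule borel_measurable_continuous_on_range)
  have [measurable]: "(\<lambda>\<omega>. G (q \<omega>) \<omega>) \<in> borel_measurable M" using G_int by simp
  have [measurable]: "dual_norm N \<in> borel_measurable borel"
    using dual_norm_continuous_on[OF N] by (rule borel_measurable_continuous_onI)
  have nn: "(\<integral>\<^sup>+\<omega>. ennreal (?V \<omega>) \<partial>M) \<le> ennreal (\<sigma>\<^sup>2)"
    using var unfolding variance_bounded_at_def .
  show "integrable M ?V"
  proof (rule integrableI_bounded)
    show "(\<integral>\<^sup>+\<omega>. ennreal (norm (?V \<omega>)) \<partial>M) < \<infinity>"
      using nn by (simp add: order_le_less_trans)
  qed measurable
  show "(\<integral>\<omega>. ?V \<omega> \<partial>M) \<le> \<sigma>\<^sup>2"
    using nn by (intro integral_real_bounded) auto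
qed

text \<open>A minimizer of \<open>f\<close> over \<open>X\<close> may lie on the boundary of \<open>D\<close>, where the Bregman divergence has no
  meaning.  The segment from such a point to any point of \<open>X \<inter> D\<close> stays in \<open>X \<inter> D\<close> except possibly
  at its end, and by convexity the values of \<open>f\<close> along it come arbitrarily close to the minimum.\<close>

lemma convex_on_le_of_interior:
  fixes f :: "'a::euclidean_space \<Rightarrow> real"
  assumes f: "convex_on X f" and D: "open D" "convex D" "X \<subseteq> closure D"
    and x: "x \<in> X" and x0: "x0 \<in> X \<inter> D" and le: "\<And>u. u \<in> X \<inter> D \<Longrightarrow> c \<le> f u"
  shows "c \<le> f x"
proof (rule field_le_epsilon)
  fix e :: real assume e: "e > 0"
  \<comment> \<open>Small enough that \<open>r \<bar>f x0 - f x\<bar> \<le> e\<close>; the added 1 only avoids division by zero.\<close>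
  define r where "r = min (1 / 2) (e / (\<bar>f x0 - f x\<bar> + 1))"
  have r: "0 < r" "r < 1" using e by (auto simp: r_def)
  have "r * \<bar>f x0 - f x\<bar> \<le> e / (\<bar>f x0 - f x\<bar> + 1) * \<bar>f x0 - f x\<bar>"
    by (intro mult_right_mono) (auto simp: r_def)
  also have "\<dots> \<le> e" using e by (simp add: field_simps)
  finally have small: "r * \<bar>f x0 - f x\<bar> \<le> e" .
  define u where "u = (1 - r) *\<^sub>R x + r *\<^sub>R x0"
  have "u \<in> X"
    unfolding u_def using r x x0 convex_on_imp_convex[OF f] by (intro convexD) auto
  moreover have "u \<in> D"
  proof (cases "x = x0")
    case True
    then show ?thesis using x0 by (simp add: u_def algebra_simps)
  next
    case False
    have "open_segment x0 x \<subseteq> interior D"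
      using D x x0 by (intro in_interior_closure_convex_segment) (auto simp: interior_open)
    moreover have "u \<in> open_segment x x0"
      using False r by (auto simp: in_segment u_def)
    ultimately show ?thesis using D(1) by (auto simp: interior_open open_segment_commute)
  qed
  ultimately have "c \<le> f u" using le by blast
  also have "\<dots> \<le> (1 - r) * f x + r * f x0"
    unfolding u_def using r x x0 by (intro convex_onD[OF f]) auto
  also have "\<dots> = f x + r * (f x0 - f x)" by (simp add: algebra_simps)
  also have "\<dots> \<le> f x + r * \<bar>f x0 - f x\<bar>" using r by simp
  finally show "c \<le> f x + e" using small by linarith
qed

section \<open>Convergence of stochastic mirror descent\<close>

theorem theorem6p3:
  fixes N :: "real^'n \<Rightarrow> real"
    and X D :: "(real^'n) set"
    and \<Phi> f :: "real^'n \<Rightarrow> real"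
    and \<Phi>' f' :: "real^'n \<Rightarrow> real^'n"
    and x1 xstar :: "real^'n"
    and R \<beta> \<sigma> \<eta> :: real
    and t :: nat
    and M :: "'w measure"
    and G :: "nat \<Rightarrow> real^'n \<Rightarrow> 'w \<Rightarrow> real^'n"
    and x :: "nat \<Rightarrow> 'w \<Rightarrow> real^'n"
  assumes "is_norm N"
    and "compact X" and "convex X"
    and "open D" and "convex D" and "X \<subseteq> closure D" and "X \<inter> D \<noteq> {}"
    and "mirror_map N D \<Phi> \<Phi>'"
    and "strongly_convex_on_wrt N 1 (X \<inter> D) \<Phi> \<Phi>'"
    and "is_arg_min \<Phi> (\<lambda>z. z \<in> X \<inter> D) x1"
    and "bdd_above (\<Phi> ` (X \<inter> D))"
    and "R > 0" and "R\<^sup>2 = (SUP z\<in>X \<inter> D. \<Phi> z) - \<Phi> x1"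
    and "convex_on X f" and "smooth_on_wrt N \<beta> X f f'"
    and "is_arg_min f (\<lambda>z. z \<in> X) xstar"
    and "prob_space M" and "\<sigma> > 0"
    and "\<And>s. s \<ge> 1 \<Longrightarrow> unbiased_on M X f' (G s)"
    and "\<And>s z. s \<ge> 1 \<Longrightarrow> z \<in> X \<Longrightarrow> variance_bounded_at N M f' (G s) \<sigma> (\<lambda>_. z)"
    and "\<And>s. s \<ge> 1 \<Longrightarrow> unbiased_at_random M f' (G s) (x s)"
    and "\<And>s. s \<ge> 1 \<Longrightarrow> variance_bounded_at N M f' (G s) \<sigma> (x s)"
    and "t \<ge> 1"
    and "\<eta> = R / \<sigma> * sqrt (2 / real t)"
    and "stochastic_mirror_descent M X D \<Phi> \<Phi>' (1 / (\<beta> + 1 / \<eta>)) G x1 x"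
  shows "(\<integral>\<omega>. f ((1 / real t) *\<^sub>R (\<Sum>s=1..t. x (s + 1) \<omega>)) \<partial>M) - f xstar
           \<le> R * \<sigma> * sqrt (2 / real t) + \<beta> * R\<^sup>2 / real t"
proof -
  note N = assms(1) and X = assms(2,3) and D = assms(4-6) and mirror = assms(8)
    and strong = assms(9) and x1_min = assms(10) and R = assms(12,13)
    and f_convex = assms(14) and smooth = assms(15) and xstar_min = assms(16)
    and \<sigma> = assms(18) and unbiased = assms(21) and var = assms(22) and t = assms(23)
    and \<eta>_eq = assms(24) and smd = assms(25)
  interpret prob_space M by fact
  define S where "S = X \<inter> D"
  have S: "convex S" "S \<subseteq> X" unfolding S_def using X(2) D(2) by (auto intro: convex_Int)
  have gderiv: "GDERIV \<Phi> z :> \<Phi>' z" if "z \<in> S" for z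
    using mirror that unfolding mirror_map_def S_def by blast
  have x1: "x1 \<in> S" using x1_min by (simp add: is_arg_min_def S_def)
  have \<eta>: "\<eta> > 0" unfolding \<eta>_eq using R(1) \<sigma> t by simp

  \<comment> \<open>Since \<open>R > 0\<close>, the feasible set has two points, which forces \<open>\<beta> \<ge> 0\<close>.\<close>
  have "\<exists>z\<in>S. z \<noteq> x1"
  proof (rule ccontr)
    assume "\<not> (\<exists>z\<in>S. z \<noteq> x1)"
    then have "X \<inter> D = {x1}" using x1 unfolding S_def by blast
    then have "R\<^sup>2 = 0" using R(2) by simp
    then show False using R(1) by simp
  qed
  then obtain z where "z \<in> X" "z \<noteq> x1" using S(2) by blast
  then have "\<beta> \<ge> 0"
    using x1 S(2) by (intro smooth_on_wrt_const_nonneg[OF N smooth, of z x1]) auto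
  then have pos: "\<beta> + 1 / \<eta> > 0" using \<eta> by (simp add: add_nonneg_pos)

  have start: "x 1 \<omega> = x1" and step: "s \<ge> 1 \<Longrightarrow> is_arg_min
      (\<lambda>z. 1 / (\<beta> + 1 / \<eta>) * (G s (x s \<omega>) \<omega> \<bullet> z) + bregman \<Phi> \<Phi>' z (x s \<omega>))
      (\<lambda>z. z \<in> S) (x (s + 1) \<omega>)" if "\<omega> \<in> space M" for s \<omega>
    using smd that unfolding stochastic_mirror_descent_def S_def by blast+
  have x_in: "x s \<omega> \<in> X" if "s \<ge> 1" "\<omega> \<in> space M" for s \<omega>
  proof (cases "s = 1")
    case True
    then show ?thesis using start[OF that(2)] x1 S(2) by auto
  next
    case False
    then have "x s \<omega> \<in> S"
      using step[OF that(2), of "s - 1"] that(1) by (simp add: is_arg_min_def)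
    then show ?thesis using S(2) by blast
  qed
  have f'_cont: "continuous_on X f'"
    by (rule smooth_on_wrt_gradient_continuous[OF N smooth])
  have f_cont: "continuous_on X f"
    using smooth unfolding smooth_on_wrt_def
    by (intro has_derivative_continuous_on) blast

  define avg where "avg \<omega> = (1 / real t) *\<^sub>R (\<Sum>s=1..t. x (s + 1) \<omega>)" for \<omega>
  have avg_sum: "avg \<omega> = (\<Sum>s=1..t. (1 / real t) *\<^sub>R x (s + 1) \<omega>)" for \<omega>
    by (simp add: avg_def scaleR_sum_right)
  have weights: "(\<Sum>s=1..t. 1 / real t) = 1" using t by simp
  have avg_in: "avg \<omega> \<in> X" if "\<omega> \<in> space M" for \<omega>
    unfolding avg_sum
    using weights x_in[OF _ that] by (intro convex_sum X(2)) auto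
  have jensen: "f (avg \<omega>) \<le> 1 / real t * (\<Sum>s=1..t. f (x (s + 1) \<omega>))" if "\<omega> \<in> space M" for \<omega>
  proof -
    have "f (avg \<omega>) \<le> (\<Sum>s=1..t. 1 / real t * f (x (s + 1) \<omega>))"
      unfolding avg_sum
      using weights x_in[OF _ that] t by (intro convex_on_sum[OF _ _ f_convex]) auto
    then show ?thesis by (simp add: sum_distrib_left)
  qed
  have avg_int: "integrable M (\<lambda>\<omega>. f (avg \<omega>))"
  proof -
    have x_meas: "x s \<in> borel_measurable M" if "s \<ge> 1" for s
      using unbiased[OF that] unfolding unbiased_at_random_def by blast
    have "avg \<in> borel_measurable M"
      unfolding avg_def
      by (intro borel_measurable_scaleR borel_measurable_const borel_measurable_sum x_meas) simp
    then have meas: "(\<lambda>\<omega>. f (avg \<omega>)) \<in> borel_measurable M"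
      using avg_in by (intro borel_measurable_continuous_on_range[OF f_cont])
    have "bounded (f ` X)"
      using f_cont X(1) by (intro compact_imp_bounded compact_continuous_image)
    then obtain B where "\<And>z. z \<in> X \<Longrightarrow> norm (f z) \<le> B" by (auto simp: bounded_iff)
    then show ?thesis using meas avg_in by (intro integrable_const_bound[of _ B] AE_I2) auto
  qed

  define bound where "bound = \<eta> / 2 * \<sigma>\<^sup>2 + (\<beta> + 1 / \<eta>) * R\<^sup>2 / real t"
  have comparator: "(\<integral>\<omega>. f (avg \<omega>) \<partial>M) - bound \<le> f u" if u: "u \<in> S" for u
  proof -
    \<comment> \<open>Minimality of the starting point makes the linear term of the divergence harmless.\<close>
    have "(u - x1) \<bullet> \<Phi>' x1 \<ge> 0"
      using gderiv[OF x1] x1_min[folded S_def]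
      by (intro arg_min_first_order[OF S(1) _ u]) (auto simp: S_def gderiv_def intro: has_derivative_at_withinI)
    moreover have "\<Phi> u \<le> (SUP z\<in>X \<inter> D. \<Phi> z)"
      using u assms(11) unfolding S_def by (rule cSUP_upper)
    ultimately have start_le: "bregman \<Phi> \<Phi>' u x1 \<le> R\<^sup>2"
      unfolding bregman_def R(2) by (simp add: inner_commute)

    define noise where "noise s \<omega> = (G s (x s \<omega>) \<omega> - f' (x s \<omega>)) \<bullet> (u - x s \<omega>)" for s \<omega>
    define V where "V s \<omega> = (dual_norm N (f' (x s \<omega>) - G s (x s \<omega>) \<omega>))\<^sup>2" for s \<omega>
    have noise: "integrable M (noise s)" "(\<integral>\<omega>. noise s \<omega> \<partial>M) = 0" if "s \<ge> 1" for s
      using unbiased_noise_orthogonal[OF assms(17) X(1) f'_cont unbiased[OF that] x_in[OF that]]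
      unfolding noise_def by auto
    have V: "integrable M (V s)" "(\<integral>\<omega>. V s \<omega> \<partial>M) \<le> \<sigma>\<^sup>2" if "s \<ge> 1" for s
      using variance_bounded_at_expectation[OF N f'_cont unbiased[OF that] x_in[OF that] var[OF that]]
      unfolding V_def by auto

    have path: "f (avg \<omega>) \<le> f u + 1 / real t * (\<Sum>s=1..t. noise s \<omega> + \<eta> / 2 * V s \<omega>)
        + (\<beta> + 1 / \<eta>) * R\<^sup>2 / real t" if \<omega>: "\<omega> \<in> space M" for \<omega>
    proof -
      have "(\<Sum>s=1..t. f (x (s + 1) \<omega>)) \<le> real t * f u
          + (\<Sum>s=1..t. noise s \<omega> + \<eta> / 2 * V s \<omega>) + (\<beta> + 1 / \<eta>) * bregman \<Phi> \<Phi>' u x1"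
        using noisy_mirror_descent_telescope[OF N f_convex smooth S strong[folded S_def] gderiv \<eta> pos u,
            of "\<lambda>s. x s \<omega>" "\<lambda>s. G s (x s \<omega>) \<omega>" t] step[OF \<omega>] start[OF \<omega>] x1
        unfolding noise_def V_def by simp
      also have "\<dots> \<le> real t * f u
          + (\<Sum>s=1..t. noise s \<omega> + \<eta> / 2 * V s \<omega>) + (\<beta> + 1 / \<eta>) * R\<^sup>2"
        using start_le pos by (intro add_left_mono mult_left_mono) auto
      finally have "1 / real t * (\<Sum>s=1..t. f (x (s + 1) \<omega>)) \<le> 1 / real t * (real t * f u
          + (\<Sum>s=1..t. noise s \<omega> + \<eta> / 2 * V s \<omega>) + (\<beta> + 1 / \<eta>) * R\<^sup>2)"
        by (rule mult_left_mono) simp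
      also have "\<dots> = f u + 1 / real t * (\<Sum>s=1..t. noise s \<omega> + \<eta> / 2 * V s \<omega>)
          + (\<beta> + 1 / \<eta>) * R\<^sup>2 / real t"
        using t by (simp add: distrib_left)
      finally show ?thesis using jensen[OF \<omega>] by linarith
    qed
    have sum_int: "integrable M (\<lambda>\<omega>. \<Sum>s=1..t. noise s \<omega> + \<eta> / 2 * V s \<omega>)"
      by (intro Bochner_Integration.integrable_sum Bochner_Integration.integrable_add
          integrable_mult_right noise V) auto
    have "(\<integral>\<omega>. (\<Sum>s=1..t. noise s \<omega> + \<eta> / 2 * V s \<omega>) \<partial>M)
        = (\<Sum>s=1..t. \<integral>\<omega>. noise s \<omega> + \<eta> / 2 * V s \<omega> \<partial>M)"
      by (intro Bochner_Integration.integral_sum Bochner_Integration.integrable_add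
          integrable_mult_right noise V) auto
    also have "\<dots> = (\<Sum>s=1..t. \<eta> / 2 * (\<integral>\<omega>. V s \<omega> \<partial>M))"
      by (intro sum.cong refl) (simp add: noise V)
    also have "\<dots> \<le> (\<Sum>s=1..t. \<eta> / 2 * \<sigma>\<^sup>2)"
      using \<eta> by (intro sum_mono mult_left_mono V) auto
    finally have mean: "(\<integral>\<omega>. (\<Sum>s=1..t. noise s \<omega> + \<eta> / 2 * V s \<omega>) \<partial>M) \<le> real t * (\<eta> / 2 * \<sigma>\<^sup>2)"
      by simp
    have "(\<integral>\<omega>. f (avg \<omega>) \<partial>M) \<le> (\<integral>\<omega>. f u + 1 / real t * (\<Sum>s=1..t. noise s \<omega> + \<eta> / 2 * V s \<omega>)
        + (\<beta> + 1 / \<eta>) * R\<^sup>2 / real t \<partial>M)"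
      by (intro integral_mono avg_int path Bochner_Integration.integrable_add
          integrable_mult_right sum_int integrable_const) auto
    also have "\<dots> = f u + 1 / real t * (\<integral>\<omega>. (\<Sum>s=1..t. noise s \<omega> + \<eta> / 2 * V s \<omega>) \<partial>M)
        + (\<beta> + 1 / \<eta>) * R\<^sup>2 / real t"
      using sum_int by (simp add: prob_space del: integral_sum Bochner_Integration.integral_sum)
    also have "\<dots> \<le> f u + 1 / real t * (real t * (\<eta> / 2 * \<sigma>\<^sup>2)) + (\<beta> + 1 / \<eta>) * R\<^sup>2 / real t"
      using mean by (intro add_mono mult_left_mono) auto
    also have "\<dots> = f u + bound" using t by (simp add: bound_def)
    finally show ?thesis by simp
  qed

  have "xstar \<in> X" using xstar_min by (simp add: is_arg_min_def)
  then have "(\<integral>\<omega>. f (avg \<omega>) \<partial>M) - bound \<le> f xstar"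
    using convex_on_le_of_interior[OF f_convex D, of xstar x1] comparator x1
    unfolding S_def by blast
  moreover have "bound = R * \<sigma> * sqrt (2 / real t) + \<beta> * R\<^sup>2 / real t"
  proof -
    \<comment> \<open>The choice of \<open>\<eta>\<close> balances the two terms depending on it: each becomes \<open>R \<sigma> sqrt (2 / t) / 2\<close>.\<close>
    define q where "q = sqrt (2 / real t)"
    have q: "q > 0" "q\<^sup>2 = 2 / real t" using t by (auto simp: q_def)
    have "\<eta> / 2 * \<sigma>\<^sup>2 = R * \<sigma> * q / 2"
      unfolding \<eta>_eq q_def[symmetric] using \<sigma> by (simp add: field_simps power2_eq_square)
    moreover have "1 / \<eta> * R\<^sup>2 / real t = R * \<sigma> * q / 2"
    proof -
      have "1 / \<eta> * R\<^sup>2 / real t = R * \<sigma> / q * (q\<^sup>2 / 2)"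
        unfolding \<eta>_eq q_def[symmetric] q(2) using \<sigma> R(1) q(1)
        by (simp add: field_simps power2_eq_square)
      then show ?thesis using q(1) by (simp add: power2_eq_square)
    qed
    moreover have "(\<beta> + 1 / \<eta>) * R\<^sup>2 / real t = \<beta> * R\<^sup>2 / real t + 1 / \<eta> * R\<^sup>2 / real t"
      by (simp only: distrib_right add_divide_distrib)
    ultimately show ?thesis unfolding bound_def q_def by linarith
  qed
  ultimately show ?thesis unfolding avg_def by linarith
qed

end
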